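(* Let $n_1,n_2,m$ be positive integers and let $F_a\in\mathbb{C}^{2n_1\times 2n_1}$, $F_b\in\mathbb{C}^{2n_1\times 2n_2}$, $F_c\in\mathbb{C}^{2n_2\times 2n_1}$, $F_d\in\mathbb{C}^{2n_2\times 2n_2}$, $G_a\in\mathbb{C}^{2n_1\times 2m}$, $G_b\in\mathbb{C}^{2n_2\times 2m}$, $H_a\in\mathbb{C}^{2m\times 2n_1}$, $H_b\in\mathbb{C}^{2m\times 2n_2}$, $K\in\mathbb{C}^{2m\times 2m}$ be fixed ($\varepsilon$-independent) matrices of doubled-up form. For $\varepsilon>0$ consider the singularly perturbed linear complex quantum system $$ \begin{aligned} \begin{bmatrix} da_1(t)\\ da_1(t)^\#\end{bmatrix} &= F_a\begin{bmatrix} a_1(t)\\ a_1(t)^\#\end{bmatrix}dt + F_b\begin{bmatrix} a_2(t)\\ a_2(t)^\#\end{bmatrix}dt + G_a\begin{bmatrix} du(t)\\ du(t)^\#\end{bmatrix},\\ \varepsilon\begin{bmatrix} da_2(t)\\ da_2(t)^\#\end{bmatrix} &= F_c\begin{bmatrix} a_1(t)\\ a_1(t)^\#\end{bmatrix}dt + F_d\begin{bmatrix} a_2(t)\\ a_2(t)^\#\end{bmatrix}dt + G_b\begin{bmatrix} du(t)\\ du(t)^\#\end{bmatrix},\\ \begin{bmatrix} dy(t)\\ dy(t)^\#\end{bmatrix} &= H_a\begin{bmatrix} a_1(t)\\ a_1(t)^\#\end{bmatrix}dt + H_b\begin{bmatrix} a_2(t)\\ a_2(t)^\#\end{bmatrix}dt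 + K\begin{bmatrix} du(t)\\ du(t)^\#\end{bmatrix}. \end{aligned} $$ Suppose that this system is physically realizable for all $\varepsilon>0$ and that the matrix $F_d$ is non-singular. Define the reduced dimension approximate system (obtained by formally setting $\varepsilon=0$) by the matrices $$F_0=F_a-F_bF_d^{-1}F_c,\quad G_0=G_a-F_bF_d^{-1}G_b,\quad H_0=H_a-H_bF_d^{-1}F_c,\quad K_0=K-H_bF_d^{-1}G_b,$$ and its transfer function matrix by $\Phi_0(s)=H_0(sI-F_0)^{-1}G_0+K_0$. Then $\Phi_0$ is $(J,J)$-unitary, that is, $$\Phi_0^\sim(s)\,J\,\Phi_0(s)=J\qquad\text{for all } s\in\mathbb{C}$$ (as an identity of rational matrix functions of $s$).
   Context: Notation. For a complex matrix $X$, $X^\#$ is the entrywise complex conjugate, $X^T$ the transpose and $X^\dagger=(X^\#)^T$ the conjugate transpose; applied to (vectors of) operators, $(\cdot)^\#$ is the (entrywise) operator adjoint. A matrix is of doubled-up form if it can be partitioned as $\begin{bmatrix} X_1 & X_2\\ X_2^\# & X_1^\#\end{bmatrix}$ with $X_1,X_2$ of equal size. $J=\begin{bmatrix} I&0\\0&-I\end{bmatrix}$, with two identity blocks of equal size, the size being determined by context (total size $2m$ or $2n$). For a rational matrix function $\Gamma(s)$, $\Gamma^\sim(s)=\big(\Gamma(-s^* )\big)^\dagger$, where $s^*$ is the complex conjugate of $s$; $\Gamma$ is $(J,J)$-unitary if $\Gamma^\sim(s)J\Gamma(s)=J$ for all $s\in\mathbb{C}$. Linear quantum systems. A linear quantum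 system is described by quantum stochastic differential equations $$\begin{bmatrix} da\\ da^\#\end{bmatrix}=F\begin{bmatrix} a\\ a^\#\end{bmatrix}dt+G\begin{bmatrix} du\\ du^\#\end{bmatrix},\qquad \begin{bmatrix} dy\\ dy^\#\end{bmatrix}=H\begin{bmatrix} a\\ a^\#\end{bmatrix}dt+K\begin{bmatrix} du\\ du^\#\end{bmatrix},$$ where $a=(a_1,\dots,a_n)^T$ is a vector of linear combinations of annihilation and creation operators of $n$ harmonic oscillators, $u$ is the input, and $F\in\mathbb{C}^{2n\times 2n}$, $G\in\mathbb{C}^{2n\times 2m}$, $H\in\mathbb{C}^{2m\times 2n}$, $K\in\mathbb{C}^{2m\times 2m}$ are all of doubled-up form. For the purposes of the statement such a system is identified with the matrices $(F,G,H,K)$. Physical realizability. The system $(F,G,H,K)$ is physically realizable if there exist a commutation matrix $\Theta=\Theta^\dagger=TJT^\dagger$ with $T\in\mathbb{C}^{2n\times 2n}$ non-singular of doubled-up form, a Hamiltonian matrix $M=M^\dagger\in\mathbb{C}^{2n\times 2n}$ of doubled-up form, a coupling matrix $N\in\mathbb{C}^{2m\times 2n}$ of doubled-up form, and a unitary scattering matrix $S\in\mathbb{C}^{m\times m}$ ($S^{-1}=S^\dagger$) such that $$F=-i\Theta M-\tfrac12\Theta N^\dagger JN,\quad G=-\Theta N^\dagger JK,\quad H=N,\quad K=\begin{bmatrix} S&0\\0&S^\#\end{bmatrix}.$$ For a fixed $\varepsilon>0$, the singularly perturbed system is regarded as a linear quantum system with $n=n_1+n_2$ by dividing its second equation by $\varepsilon$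 and ordering the variables as $(a_1,a_2,a_1^\#,a_2^\#)$, so that its matrices are of doubled-up form with respect to $a=(a_1^T,a_2^T)^T$; physical realizability of the singularly perturbed system refers to this system (the matrices $\Theta,M,N,S$ may depend on $\varepsilon$). *)

theory Defs
  imports
    "HOL-Analysis.Analysis"
    "HOL-Computational_Algebra.Computational_Algebra"
begin

section \<open>Block matrices and matrices of doubled-up form\<close>

text \<open>A space of dimension \<open>2k\<close> is indexed by \<open>'k + 'k\<close>, where \<open>Inl\<close> selects the upper
  and \<open>Inr\<close> the lower half, and a space of dimension \<open>n\<^sub>1 + n\<^sub>2\<close> is indexed by \<open>'n1 + 'n2\<close>.\<close>

definition beside :: "'a ^ 'c ^ 'r \<Rightarrow> 'a ^ 'd ^ 'r \<Rightarrow> 'a ^ ('c + 'd) ^ 'r" where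
  "beside A B = (\<chi> r c. case c of Inl j \<Rightarrow> A $ r $ j | Inr j \<Rightarrow> B $ r $ j)"

definition above :: "'a ^ 'c ^ 'r \<Rightarrow> 'a ^ 'c ^ 's \<Rightarrow> 'a ^ 'c ^ ('r + 's)" where
  "above A B = (\<chi> r. case r of Inl i \<Rightarrow> A $ i | Inr i \<Rightarrow> B $ i)"

definition four_block ::
  "'a ^ 'c ^ 'r \<Rightarrow> 'a ^ 'd ^ 'r \<Rightarrow> 'a ^ 'c ^ 's \<Rightarrow> 'a ^ 'd ^ 's \<Rightarrow> 'a ^ ('c + 'd) ^ ('r + 's)" where
  "four_block A B C D = above (beside A B) (beside C D)"

definition conj_matrix :: "complex ^ 'c ^ 'r \<Rightarrow> complex ^ 'c ^ 'r" where
  "conj_matrix X = map_matrix cnj X"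

definition dagger :: "complex ^ 'c ^ 'r \<Rightarrow> complex ^ 'r ^ 'c" where
  "dagger X = transpose (conj_matrix X)"

definition doubled_up :: "complex ^ ('c::finite + 'c) ^ ('r::finite + 'r) \<Rightarrow> bool" where
  "doubled_up X \<longleftrightarrow> (\<exists>X1 X2. X = four_block X1 X2 (conj_matrix X2) (conj_matrix X1))"

definition Jmat :: "'a::comm_ring_1 ^ ('k::finite + 'k) ^ ('k + 'k)" where
  "Jmat = four_block (mat 1) 0 0 (- mat 1)"


section \<open>Physical realizability\<close>

definition physically_realizable ::
  "complex ^ ('n::finite + 'n) ^ ('n + 'n) \<Rightarrow> complex ^ ('m::finite + 'm) ^ ('n + 'n) \<Rightarrow>
   complex ^ ('n + 'n) ^ ('m + 'm) \<Rightarrow> complex ^ ('m + 'm) ^ ('m + 'm) \<Rightarrow> bool" where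
  "physically_realizable F G H K \<longleftrightarrow>
    (\<exists>(\<Theta> :: complex ^ ('n + 'n) ^ ('n + 'n)) (T :: complex ^ ('n + 'n) ^ ('n + 'n))
      (M :: complex ^ ('n + 'n) ^ ('n + 'n)) (N :: complex ^ ('n + 'n) ^ ('m + 'm))
      (S :: complex ^ 'm ^ 'm).
      invertible T \<and> doubled_up T \<and> \<Theta> = dagger \<Theta> \<and> \<Theta> = T ** Jmat ** dagger T \<and>
      M = dagger M \<and> doubled_up M \<and>
      doubled_up N \<and>
      invertible S \<and> matrix_inv S = dagger S \<and>
      F = map_matrix ((*) (- \<i>)) (\<Theta> ** M) - (1 / 2) *\<^sub>R (\<Theta> ** dagger N ** Jmat ** N) \<and>
      G = - (\<Theta> ** dagger N ** Jmat ** K) \<and>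
      H = N \<and>
      K = four_block S 0 0 (conj_matrix S))"


section \<open>The singularly perturbed system for fixed \<open>\<epsilon>\<close>\<close>

text \<open>The perturbed equations order the variables as \<open>(a\<^sub>1, a\<^sub>1\<^sup>#, a\<^sub>2, a\<^sub>2\<^sup>#)\<close>, whereas the doubled-up
  form for \<open>a = (a\<^sub>1, a\<^sub>2)\<close> requires the order \<open>(a\<^sub>1, a\<^sub>2, a\<^sub>1\<^sup>#, a\<^sub>2\<^sup>#)\<close>.  The function below sends an
  index of the latter ordering to the index of the same variable in the former.\<close>

fun regroup :: "('a + 'b) + ('a + 'b) \<Rightarrow> ('a + 'a) + ('b + 'b)" where
  "regroup (Inl (Inl i)) = Inl (Inl i)"
| "regroup (Inl (Inr j)) = Inr (Inl j)"
| "regroup (Inr (Inl i)) = Inl (Inr i)"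
| "regroup (Inr (Inr j)) = Inr (Inr j)"

definition regroup_rows ::
  "'e ^ 'c ^ (('a::finite + 'a) + ('b::finite + 'b)) \<Rightarrow> 'e ^ 'c ^ (('a + 'b) + ('a + 'b))" where
  "regroup_rows X = (\<chi> r c. X $ regroup r $ c)"

definition regroup_cols ::
  "'e ^ (('a::finite + 'a) + ('b::finite + 'b)) ^ 'r \<Rightarrow> 'e ^ (('a + 'b) + ('a + 'b)) ^ 'r" where
  "regroup_cols X = (\<chi> r c. X $ r $ regroup c)"

definition perturbed_F ::
  "real \<Rightarrow> complex ^ ('n1::finite + 'n1) ^ ('n1 + 'n1) \<Rightarrow> complex ^ ('n2::finite + 'n2) ^ ('n1 + 'n1) \<Rightarrow>
   complex ^ ('n1 + 'n1) ^ ('n2 + 'n2) \<Rightarrow> complex ^ ('n2 + 'n2) ^ ('n2 + 'n2) \<Rightarrow>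
   complex ^ (('n1 + 'n2) + ('n1 + 'n2)) ^ (('n1 + 'n2) + ('n1 + 'n2))" where
  "perturbed_F \<epsilon> Fa Fb Fc Fd =
    regroup_rows (regroup_cols (four_block Fa Fb ((1 / \<epsilon>) *\<^sub>R Fc) ((1 / \<epsilon>) *\<^sub>R Fd)))"

definition perturbed_G ::
  "real \<Rightarrow> complex ^ ('m::finite + 'm) ^ ('n1::finite + 'n1) \<Rightarrow> complex ^ ('m + 'm) ^ ('n2::finite + 'n2) \<Rightarrow>
   complex ^ ('m + 'm) ^ (('n1 + 'n2) + ('n1 + 'n2))" where
  "perturbed_G \<epsilon> Ga Gb = regroup_rows (above Ga ((1 / \<epsilon>) *\<^sub>R Gb))"

definition perturbed_H ::
  "complex ^ ('n1::finite + 'n1) ^ ('m::finite + 'm) \<Rightarrow> complex ^ ('n2::finite + 'n2) ^ ('m + 'm) \<Rightarrow>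
   complex ^ (('n1 + 'n2) + ('n1 + 'n2)) ^ ('m + 'm)" where
  "perturbed_H Ha Hb = regroup_cols (beside Ha Hb)"


section \<open>Rational matrix functions\<close>

text \<open>Rational functions of \<open>s\<close> are elements of the field \<open>\<complex>(s)\<close>, i.e. the fraction field of
  \<open>\<complex>[s]\<close>, so that an identity between them does not depend on the points at which a chosen
  representation is undefined.\<close>

type_synonym ratfun = "complex poly fract"

definition rat_const :: "complex \<Rightarrow> ratfun" where
  "rat_const c = to_fract [:c:]"

definition rat_s :: ratfun where
  "rat_s = to_fract [:0, 1:]"

text \<open>The map \<open>r \<mapsto> (s \<mapsto> (r(-s\<^sup>*))\<^sup>*)\<close>, first on polynomials and then on rational functions;
  the lemmas \<open>poly_para_poly\<close> and \<open>eval_para_conj\<close> confirm this reading.\<close>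

definition para_poly :: "complex poly \<Rightarrow> complex poly" where
  "para_poly p = map_poly cnj p \<circ>\<^sub>p [:0, -1:]"

lemma poly_para_poly: "poly (para_poly p) s = cnj (poly p (- cnj s))"
  by (simp add: para_poly_def poly_pcompose)

lemma para_poly_mult: "para_poly (p * q) = para_poly p * para_poly q"
  by (simp add: poly_eq_poly_eq_iff [symmetric] fun_eq_iff poly_para_poly)

lemma para_poly_eq_0_iff [simp]: "para_poly p = 0 \<longleftrightarrow> p = 0"
proof
  assume "para_poly p = 0"
  then have "cnj (poly p (- cnj (- cnj z))) = 0" for z
    by (metis poly_para_poly poly_0)
  then have "poly p = poly 0"
    by (simp add: fun_eq_iff)
  then show "p = 0"
    by (simp only: poly_eq_poly_eq_iff)
qed (simp add: para_poly_def)

definition para_conj :: "ratfun \<Rightarrow> ratfun" where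
  "para_conj r = (THE t. \<exists>p q. q \<noteq> 0 \<and> r = Fract p q \<and> t = Fract (para_poly p) (para_poly q))"

lemma para_conj_Fract:
  assumes "q \<noteq> 0"
  shows "para_conj (Fract p q) = Fract (para_poly p) (para_poly q)"
  unfolding para_conj_def
proof (rule the_equality)
  fix t
  assume "\<exists>p' q'. q' \<noteq> 0 \<and> Fract p q = Fract p' q' \<and> t = Fract (para_poly p') (para_poly q')"
  then obtain p' q' where "q' \<noteq> 0" "Fract p q = Fract p' q'"
    and t: "t = Fract (para_poly p') (para_poly q')" by blast
  then have "p * q' = p' * q"
    using assms by (simp add: eq_fract)
  then have "para_poly p * para_poly q' = para_poly p' * para_poly q"
    by (metis para_poly_mult)
  then show "t = Fract (para_poly p) (para_poly q)"
    using assms \<open>q' \<noteq> 0\<close> t by (simp add: eq_fract)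
qed (use assms in blast)

lemma eval_para_conj:
  assumes "q \<noteq> 0"
  obtains p' q' where "para_conj (Fract p q) = Fract p' q'" and "q' \<noteq> 0"
    and "\<And>s. poly q' s = 0 \<longleftrightarrow> poly q (- cnj s) = 0"
    and "\<And>s. poly p' s / poly q' s = cnj (poly p (- cnj s) / poly q (- cnj s))"
  using that [of "para_poly p" "para_poly q"] assms
  by (simp add: para_conj_Fract poly_para_poly)

definition para :: "ratfun ^ 'c ^ 'r \<Rightarrow> ratfun ^ 'r ^ 'c" where
  "para \<Gamma> = transpose (map_matrix para_conj \<Gamma>)"

definition JJ_unitary :: "ratfun ^ ('m::finite + 'm) ^ ('m + 'm) \<Rightarrow> bool" where
  "JJ_unitary \<Gamma> \<longleftrightarrow> para \<Gamma> ** Jmat ** \<Gamma> = Jmat"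

text \<open>Over \<open>\<complex>(s)\<close> the matrix \<open>s I - F\<close> is always invertible, since its determinant is the
  characteristic polynomial of \<open>F\<close>.\<close>

definition transfer_function ::
  "complex ^ 'n ^ 'n \<Rightarrow> complex ^ 'm ^ 'n \<Rightarrow> complex ^ 'n ^ 'p \<Rightarrow> complex ^ 'm ^ 'p \<Rightarrow>
   ratfun ^ 'm ^ 'p" where
  "transfer_function F G H K =
    map_matrix rat_const H ** matrix_inv (mat rat_s - map_matrix rat_const F)
      ** map_matrix rat_const G + map_matrix rat_const K"

end

theory Submission
  imports Defs
begin

no_notation fps_nth (infixl "$" 75)

text \<open>For \<open>\<epsilon> > 0\<close> the inverse \<open>P\<close> of the commutation matrix satisfies
  \<open>P F + F\<^sup>\<dagger> P = - H\<^sup>\<dagger> J H\<close> and \<open>P G = - H\<^sup>\<dagger> J K\<close>, which makes the perturbed transfer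
  function \<open>(J,J)\<close>-unitary.  Multiplying the second block row of \<open>s I - F\<close> by \<open>\<epsilon>\<close> gives a matrix
  pencil that is continuous up to \<open>\<epsilon> = 0\<close>, where its Schur complement is \<open>s I - F\<^sub>0\<close>; so for all but
  finitely many \<open>s\<close> the identity survives the limit \<open>\<epsilon> \<rightarrow> 0\<close>, and a rational function
  vanishing at all but finitely many points is zero.\<close>

section \<open>Matrix algebra\<close>

lemma matrix_eqI: "(\<And>i j. A $ i $ j = B $ i $ j) \<Longrightarrow> A = B"
  by (simp add: vec_eq_iff)

lemma matrix_mult_nth: "(A ** B) $ i $ j = (\<Sum>k\<in>UNIV. A $ i $ k * B $ k $ j)"
  by (simp add: matrix_matrix_mult_def)

lemma matrix_add_rdistrib:
  fixes A B :: "'a::semiring_1 ^ 'n ^ 'm" and C :: "'a ^ 'p ^ 'n"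
  shows "(A + B) ** C = A ** C + B ** C"
  by (rule matrix_eqI) (simp add: matrix_mult_nth sum.distrib distrib_right)

lemma matrix_minus_left [simp]:
  fixes A :: "'a::ring_1 ^ 'n ^ 'm" and C :: "'a ^ 'p ^ 'n"
  shows "(- A) ** C = - (A ** C)"
  by (rule matrix_eqI) (simp add: matrix_mult_nth sum_negf)

lemma matrix_minus_right [simp]:
  fixes A :: "'a::ring_1 ^ 'n ^ 'm" and C :: "'a ^ 'p ^ 'n"
  shows "A ** (- C) = - (A ** C)"
  by (rule matrix_eqI) (simp add: matrix_mult_nth sum_negf)

lemma matrix_diff_ldistrib:
  fixes A :: "'a::ring_1 ^ 'n ^ 'm" and B C :: "'a ^ 'p ^ 'n"
  shows "A ** (B - C) = A ** B - A ** C"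
  by (rule matrix_eqI) (simp add: matrix_mult_nth sum_subtractf right_diff_distrib)

lemma matrix_diff_rdistrib:
  fixes A B :: "'a::ring_1 ^ 'n ^ 'm" and C :: "'a ^ 'p ^ 'n"
  shows "(A - B) ** C = A ** C - B ** C"
  by (rule matrix_eqI) (simp add: matrix_mult_nth sum_subtractf left_diff_distrib)

lemma mat_mult_nth [simp]:
  fixes A :: "'a::semiring_1 ^ 'm ^ 'n"
  shows "(mat c ** A) $ i $ j = c * A $ i $ j"
  by (simp add: matrix_mult_nth mat_def if_distrib if_distribR sum.delta' cong: if_cong)

lemma mult_mat_nth [simp]:
  fixes A :: "'a::semiring_1 ^ 'n ^ 'm"
  shows "(A ** mat c) $ i $ j = A $ i $ j * c"
  by (simp add: matrix_mult_nth mat_def if_distrib if_distribR sum.delta' cong: if_cong)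

lemma mat_mult_commute:
  fixes A :: "'a::comm_semiring_1 ^ 'n ^ 'm"
  shows "A ** mat c = mat c ** A"
  by (rule matrix_eqI) (simp add: mult.commute)

lemma matrix_mult_map_times:
  fixes A :: "'a::comm_semiring_1 ^ 'n ^ 'm"
  shows "A ** map_matrix ((*) c) B = map_matrix ((*) c) (A ** B)"
  by (rule matrix_eqI) (simp add: matrix_mult_nth sum_distrib_left mult_ac)

lemma
  fixes A :: "'a::semiring_1 ^ 'n ^ 'n"
  assumes "invertible A"
  shows matrix_mult_matrix_inv: "A ** matrix_inv A = mat 1"
    and matrix_inv_matrix_mult: "matrix_inv A ** A = mat 1"
proof -
  obtain B where "A ** B = mat 1 \<and> B ** A = mat 1"
    using assms by (auto simp: invertible_def)
  then have "A ** matrix_inv A = mat 1 \<and> matrix_inv A ** A = mat 1"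
    unfolding matrix_inv_def by (rule someI)
  then show "A ** matrix_inv A = mat 1" "matrix_inv A ** A = mat 1" by auto
qed

section \<open>Conjugate transposes\<close>

lemma dagger_nth [simp]: "dagger A $ i $ j = cnj (A $ j $ i)"
  by (simp add: dagger_def conj_matrix_def transpose_def)

lemma dagger_dagger [simp]: "dagger (dagger A) = A"
  by (rule matrix_eqI) simp

lemma dagger_mult: "dagger (A ** B) = dagger B ** dagger A"
  by (rule matrix_eqI) (simp add: matrix_mult_nth mult.commute)

lemma dagger_add: "dagger (A + B) = dagger A + dagger B"
  by (rule matrix_eqI) simp

lemma dagger_minus: "dagger (- A) = - dagger A"
  by (rule matrix_eqI) simp

lemma dagger_mat: "dagger (mat c) = mat (cnj c)"
  by (rule matrix_eqI) (simp add: mat_def)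

lemma dagger_invertible:
  fixes A :: "complex ^ 'n ^ 'n"
  assumes "invertible A"
  shows "invertible (dagger A)"
proof -
  have "dagger (matrix_inv A) ** dagger A = mat 1"
    using matrix_mult_matrix_inv [OF assms] by (simp add: dagger_mult [symmetric] dagger_mat)
  then show ?thesis by (auto simp: invertible_left_inverse)
qed


section \<open>Block matrices\<close>

lemma above_nth [simp]: "above A B $ Inl i = A $ i" "above A B $ Inr i' = B $ i'"
  by (simp_all add: above_def)

lemma beside_nth [simp]: "beside A B $ r $ Inl i = A $ r $ i" "beside A B $ r $ Inr i' = B $ r $ i'"
  by (simp_all add: beside_def)

lemma sum_UNIV_Plus:
  fixes f :: "'a::finite + 'b::finite \<Rightarrow> 'c::comm_monoid_add"
  shows "(\<Sum>k\<in>UNIV. f k) = (\<Sum>i\<in>UNIV. f (Inl i)) + (\<Sum>j\<in>UNIV. f (Inr j))"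
  unfolding UNIV_Plus_UNIV [symmetric] by (subst sum.Plus) (simp_all add: comp_def)

lemma above_eq_iff: "above A B = above C D \<longleftrightarrow> A = C \<and> B = D"
proof
  assume eq: "above A B = above C D"
  have "A $ i = C $ i" "B $ j = D $ j" for i j
    using arg_cong [OF eq, of "\<lambda>X. X $ Inl i"] arg_cong [OF eq, of "\<lambda>X. X $ Inr j"] by simp_all
  then show "A = C \<and> B = D" by (simp add: vec_eq_iff)
qed simp

lemma above_cases: obtains A B where "X = above A B"
proof
  show "X = above (\<chi> i. X $ Inl i) (\<chi> i. X $ Inr i)"
    by (simp add: vec_eq_iff above_def split: sum.split)
qed

lemma above_add: "above A B + above C D = above (A + C) (B + D)"
  by (simp add: vec_eq_iff above_def split: sum.split)

lemma above_mult: "above A B ** X = above (A ** X) (B ** X)"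
  by (simp add: vec_eq_iff above_def matrix_mult_nth split: sum.split)

lemma beside_mult_above:
  fixes A :: "'a::semiring_1 ^ 'c::finite ^ 'r" and B :: "'a ^ 'd::finite ^ 'r"
  shows "beside A B ** above X Y = A ** X + B ** Y"
  by (rule matrix_eqI) (simp add: matrix_mult_nth sum_UNIV_Plus)

lemma four_block_mult_above:
  fixes A :: "'a::semiring_1 ^ 'c::finite ^ 'r" and B :: "'a ^ 'd::finite ^ 'r"
  shows "four_block A B C D ** above X Y = above (A ** X + B ** Y) (C ** X + D ** Y)"
  by (simp add: four_block_def above_mult beside_mult_above)

lemma mat_mult_above:
  fixes X :: "'a::semiring_1 ^ 'c ^ 'r::finite" and Y :: "'a ^ 'c ^ 's::finite"
  shows "mat c ** above X Y = above (mat c ** X) (mat c ** Y)"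
proof (rule matrix_eqI)
  fix i j
  show "(mat c ** above X Y) $ i $ j = above (mat c ** X) (mat c ** Y) $ i $ j"
    by (cases i) simp_all
qed

lemma dagger_Jmat [simp]: "dagger Jmat = Jmat"
proof (rule matrix_eqI)
  fix i j :: "'k::finite + 'k"
  show "dagger Jmat $ i $ j = Jmat $ i $ j"
    by (cases i; cases j) (simp_all add: Jmat_def four_block_def mat_def)
qed

lemma Jmat_mult_above:
  fixes A B :: "'a::comm_ring_1 ^ 'c ^ 'k::finite"
  shows "Jmat ** above A B = above A (- B)"
  by (simp add: Jmat_def four_block_mult_above)

lemma Jmat_mult_Jmat: "Jmat ** Jmat = (mat 1 :: 'a::comm_ring_1 ^ ('k::finite + 'k) ^ ('k + 'k))"
proof -
  have "Jmat ** Jmat = above (beside (mat 1) 0) (- beside 0 (- mat 1 :: 'a ^ 'k ^ 'k))"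
    by (subst (2) Jmat_def) (simp add: four_block_def Jmat_mult_above)
  also have "\<dots> = mat 1"
  proof (rule matrix_eqI)
    fix i j :: "'k + 'k"
    show "above (beside (mat 1) 0) (- beside 0 (- mat 1 :: 'a ^ 'k ^ 'k)) $ i $ j = mat 1 $ i $ j"
      by (cases i; cases j) (simp_all add: mat_def)
  qed
  finally show ?thesis .
qed

section \<open>Reordering of the state variables\<close>

lemma regroup_rows_mult: "regroup_rows X ** Y = regroup_rows (X ** Y)"
  by (rule matrix_eqI) (simp add: regroup_rows_def matrix_mult_nth)

lemma mat_mult_regroup_rows:
  fixes X :: "'a::semiring_1 ^ 'c ^ (('n1::finite + 'n1) + ('n2::finite + 'n2))"
  shows "mat c ** regroup_rows X = regroup_rows (mat c ** X)"
  by (rule matrix_eqI) (simp add: regroup_rows_def)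

lemma regroup_rows_add: "regroup_rows (X + Y) = regroup_rows X + regroup_rows Y"
  by (simp add: regroup_rows_def vec_eq_iff)

lemma bij_regroup: "bij (regroup :: ('a + 'b) + ('a + 'b) \<Rightarrow> ('a + 'a) + ('b + 'b))"
proof (rule bijI)
  show "inj (regroup :: ('a + 'b) + ('a + 'b) \<Rightarrow> ('a + 'a) + ('b + 'b))"
  proof (rule injI)
    fix x y :: "('a + 'b) + ('a + 'b)"
    assume "regroup x = regroup y"
    then show "x = y"
      by (cases x rule: regroup.cases; cases y rule: regroup.cases) simp_all
  qed
  show "surj (regroup :: ('a + 'b) + ('a + 'b) \<Rightarrow> ('a + 'a) + ('b + 'b))"
  proof (rule surjI)
    fix y :: "('a + 'a) + ('b + 'b)"
    show "regroup (case y of Inl (Inl i) \<Rightarrow> Inl (Inl i) | Inl (Inr i) \<Rightarrow> Inr (Inl i)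
        | Inr (Inl j) \<Rightarrow> Inl (Inr j) | Inr (Inr j) \<Rightarrow> Inr (Inr j)) = y"
      by (simp split: sum.split)
  qed
qed

text \<open>\<open>regroup\<close> is a bijection, so permuting columns and rows alike only
  reindexes the contracted sum. Hence the reordering of the variables drops out when the state or
  output matrix multiplies a regrouped solution.\<close>

lemma regroup_cols_mult_regroup_rows:
  fixes X :: "'a::semiring_1 ^ (('n1::finite + 'n1) + ('n2::finite + 'n2)) ^ 'r"
  shows "regroup_cols X ** regroup_rows Y = X ** Y"
proof (rule matrix_eqI)
  fix i j
  have "(\<Sum>k\<in>UNIV. X $ i $ regroup k * Y $ regroup k $ j) = (\<Sum>k\<in>UNIV. X $ i $ k * Y $ k $ j)"
    by (rule sum.reindex_bij_betw [OF bij_regroup])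
  then show "(regroup_cols X ** regroup_rows Y) $ i $ j = (X ** Y) $ i $ j"
    by (simp add: regroup_cols_def regroup_rows_def matrix_mult_nth)
qed


section \<open>Physically realizable systems\<close>

text \<open>The product is block diagonal: its upper block is \<open>dagger S ** S\<close>, its
  lower block is minus the entrywise conjugate of that.\<close>

lemma unitary_scattering:
  fixes S :: "complex ^ 'm::finite ^ 'm"
  assumes "invertible S" "matrix_inv S = dagger S"
    and K: "K = four_block S 0 0 (conj_matrix S)"
  shows "dagger K ** Jmat ** K = Jmat"
proof -
  have "dagger S ** S = mat 1"
    using matrix_inv_matrix_mult [OF assms(1)] assms(2) by simp
  then have eq: "(\<Sum>k\<in>UNIV. cnj (S $ k $ i) * S $ k $ j) = (if i = j then 1 else 0)" for i j
    by (simp add: vec_eq_iff matrix_mult_nth mat_def)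
  \<comment> \<open>Conjugating the orthonormality of the columns of \<open>S\<close> gives that of
    the columns of \<open>conj_matrix S\<close>, which the lower block requires.\<close>
  have eq': "(\<Sum>k\<in>UNIV. S $ k $ i * cnj (S $ k $ j)) = (if i = j then 1 else 0)" for i j
    using arg_cong [OF eq [of i j], of cnj] by (simp split: if_splits)
  have JK: "Jmat ** K = above (beside S 0) (- beside 0 (conj_matrix S))"
    by (simp add: K four_block_def Jmat_mult_above)
  have "dagger K ** (Jmat ** K) = Jmat"
  proof (rule matrix_eqI)
    fix i j
    show "(dagger K ** (Jmat ** K)) $ i $ j = Jmat $ i $ j"
      unfolding JK
      by (cases i; cases j)
        (simp_all add: K matrix_mult_nth sum_UNIV_Plus Jmat_def four_block_def
          conj_matrix_def sum_negf eq eq' mat_def)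
  qed
  then show ?thesis by (simp add: matrix_mul_assoc)
qed

text \<open>With \<open>P\<close> the inverse of \<open>\<Theta>\<close>, the product
  \<open>P ** F\<close> is -iM minus half of \<open>dagger N ** Jmat ** N\<close>. The first term is
  skew-Hermitian and cancels against its adjoint; the two halves of the Hermitian second term add
  up. This is a Lyapunov-type equation whose Hermitian \<open>P\<close> need not be
  positive.\<close>

lemma physically_realizable_storage:
  fixes F :: "complex ^ ('n::finite + 'n) ^ ('n + 'n)"
    and G :: "complex ^ ('m::finite + 'm) ^ ('n + 'n)"
  assumes "physically_realizable F G H K"
  obtains P where "dagger P = P"
    and "P ** F + dagger F ** P = - (dagger H ** Jmat ** H)"
    and "P ** G = - (dagger H ** Jmat ** K)"
    and "dagger K ** Jmat ** K = Jmat"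
proof -
  from assms obtain \<Theta> T M :: "complex ^ ('n + 'n) ^ ('n + 'n)"
      and N :: "complex ^ ('n + 'n) ^ ('m + 'm)" and S :: "complex ^ 'm ^ 'm"
    where T: "invertible T" and \<Theta>: "\<Theta> = dagger \<Theta>" "\<Theta> = T ** Jmat ** dagger T"
      and M: "M = dagger M" and S: "invertible S" "matrix_inv S = dagger S"
      and F: "F = map_matrix ((*) (- \<i>)) (\<Theta> ** M) - (1 / 2) *\<^sub>R (\<Theta> ** dagger N ** Jmat ** N)"
      and G: "G = - (\<Theta> ** dagger N ** Jmat ** K)"
      and H: "H = N" and K: "K = four_block S 0 0 (conj_matrix S)"
    unfolding physically_realizable_def by blast
  have "invertible (Jmat :: complex ^ ('n + 'n) ^ ('n + 'n))"
    using Jmat_mult_Jmat by (auto simp: invertible_left_inverse)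
  then have inv: "invertible \<Theta>"
    unfolding \<Theta>(2) by (intro invertible_mult dagger_invertible T)
  define P where "P = matrix_inv \<Theta>"
  have P\<Theta>: "P ** \<Theta> = mat 1" "\<Theta> ** P = mat 1"
    using inv by (simp_all add: P_def matrix_mult_matrix_inv matrix_inv_matrix_mult)
  have P\<Theta>X: "P ** (\<Theta> ** X) = X" for X :: "complex ^ 'k ^ ('n + 'n)"
    by (simp add: matrix_mul_assoc P\<Theta>)
  \<comment> \<open>The adjoint of \<open>\<Theta> ** P = mat 1\<close> makes
    \<open>dagger P\<close> a left inverse of the Hermitian \<open>\<Theta>\<close>, and a left
    inverse coincides with the right inverse \<open>P\<close>.\<close>
  have "dagger P ** \<Theta> = mat 1"
    using arg_cong [OF P\<Theta>(2), of dagger] by (simp add: dagger_mult \<Theta>(1) [symmetric] dagger_mat)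
  then have P: "dagger P = P"
    by (metis P\<Theta>(2) matrix_mul_assoc matrix_mul_lid matrix_mul_rid)
  define L where "L = dagger N ** Jmat ** N"
  have L: "dagger L = L"
    by (simp add: L_def dagger_mult matrix_mul_assoc)
  have PF: "P ** F = map_matrix ((*) (- \<i>)) M - (1 / 2) *\<^sub>R L"
    by (simp add: F matrix_diff_ldistrib matrix_mult_map_times matrix_scalar_ac P\<Theta>X
        matrix_mul_assoc [symmetric] L_def scalar_matrix_assoc [symmetric])
  have M': "cnj (M $ j $ i) = M $ i $ j" and L': "cnj (L $ j $ i) = L $ i $ j" for i j
    using arg_cong [OF M, of "\<lambda>X. X $ i $ j"] arg_cong [OF L, of "\<lambda>X. X $ i $ j"] by simp_all
  have "P ** F + dagger (P ** F) = - L"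
    unfolding PF by (rule matrix_eqI) (simp, simp add: M' L' scaleR_conv_of_real)
  moreover have "dagger (P ** F) = dagger F ** P"
    by (simp add: dagger_mult P)
  moreover have "P ** G = - (dagger H ** Jmat ** K)"
    by (simp add: G H P\<Theta>X matrix_mul_assoc [symmetric])
  ultimately show ?thesis
    using that [OF P] unitary_scattering [OF S K] by (simp add: L_def H)
qed

text \<open>\<open>X\<close> and \<open>Y\<close> play the role of the resolvent applied to
  \<open>G\<close>, at \<open>s\<close> and at \<open>- cnj s\<close>; giving them by linear
  equations avoids any inverse. Expanding the product and inserting the equations for
  \<open>P\<close> leaves \<open>Jmat\<close> and terms that cancel because the conjugate of
  \<open>- cnj s\<close> is \<open>- s\<close>.\<close>

lemma transfer_unitary:
  fixes X Y :: "complex ^ ('m::finite + 'm) ^ ('n::finite + 'n)"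
  assumes real: "physically_realizable F G H K"
    and X: "mat s ** X = G + F ** X"
    and Y: "mat (- cnj s) ** Y = G + F ** Y"
  shows "dagger (H ** Y + K) ** Jmat ** (H ** X + K) = Jmat"
proof -
  obtain P where P: "dagger P = P"
    and HH: "P ** F + dagger F ** P = - (dagger H ** Jmat ** H)"
    and HK: "P ** G = - (dagger H ** Jmat ** K)"
    and KK: "dagger K ** Jmat ** K = Jmat"
    using physically_realizable_storage [OF real] by blast
  have HH': "dagger H ** Jmat ** H = - (P ** F + dagger F ** P)"
    by (simp add: HH)
  have HK': "dagger H ** Jmat ** K = - (P ** G)"
    by (simp add: HK)
  have KH': "dagger K ** Jmat ** H = - (dagger G ** P)"
    using arg_cong [OF HK', of dagger] by (simp add: dagger_mult dagger_minus P matrix_mul_assoc)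
  \<comment> \<open>Both scalars are moved to the front, where they appear as \<open>s\<close> and
    \<open>- s\<close>.\<close>
  have "dagger Y ** P ** (mat s ** X) = mat s ** (dagger Y ** P ** X)"
    by (metis mat_mult_commute matrix_mul_assoc)
  moreover have "dagger (mat (- cnj s) ** Y) ** P ** X = mat (- s) ** (dagger Y ** P ** X)"
    by (simp add: dagger_mult dagger_mat mat_mult_commute matrix_mul_assoc)
  moreover have "mat s ** (dagger Y ** P ** X) + mat (- s) ** (dagger Y ** P ** X) = 0"
    by (rule matrix_eqI) simp
  ultimately have "dagger Y ** P ** (mat s ** X) + dagger (mat (- cnj s) ** Y) ** P ** X = 0"
    by simp
  then have cancel: "dagger Y ** P ** (G + F ** X) + dagger (G + F ** Y) ** P ** X = 0"
    by (simp add: X Y)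
  have "dagger (H ** Y + K) ** Jmat ** (H ** X + K) =
      dagger Y ** (dagger H ** Jmat ** H) ** X + dagger Y ** (dagger H ** Jmat ** K)
        + dagger K ** Jmat ** H ** X + dagger K ** Jmat ** K"
    by (simp add: dagger_add dagger_mult matrix_add_ldistrib matrix_add_rdistrib matrix_mul_assoc
        add_ac)
  \<comment> \<open>After substitution, the terms with \<open>F\<close> and \<open>G\<close> group
    into the right-hand sides of the equations for \<open>X\<close> and \<open>Y\<close>, which is
    the combination that \<open>cancel\<close> annihilates.\<close>
  also have "\<dots> = Jmat - (dagger Y ** P ** (G + F ** X) + dagger (G + F ** Y) ** P ** X)"
    unfolding HH' HK' KH' KK
    by (simp add: dagger_add dagger_mult matrix_add_ldistrib matrix_add_rdistrib
        matrix_diff_ldistrib matrix_diff_rdistrib matrix_mul_assoc algebra_simps)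
  finally show ?thesis by (simp add: cancel)
qed


section \<open>The limit of vanishing perturbation\<close>

lemma tendsto_matrixI:
  assumes "\<And>i j. ((\<lambda>x. A x $ i $ j) \<longlongrightarrow> a $ i $ j) F"
  shows "(A \<longlongrightarrow> a) F"
  by (intro vec_tendstoI assms)

lemma tendsto_matrix_mult [tendsto_intros]:
  fixes A :: "'x \<Rightarrow> 'a::real_normed_algebra_1 ^ 'n ^ 'm"
  assumes "(A \<longlongrightarrow> a) F" "(B \<longlongrightarrow> b) F"
  shows "((\<lambda>x. A x ** B x) \<longlongrightarrow> a ** b) F"
  by (rule tendsto_matrixI)
    (unfold matrix_mult_nth, intro tendsto_intros assms)

lemma tendsto_dagger [tendsto_intros]:
  assumes "(A \<longlongrightarrow> a) F"
  shows "((\<lambda>x. dagger (A x)) \<longlongrightarrow> dagger a) F"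
  by (rule tendsto_matrixI) (unfold dagger_nth, intro tendsto_intros assms)

lemma tendsto_det [tendsto_intros]:
  fixes A :: "'x \<Rightarrow> 'a::{real_normed_algebra_1, comm_ring_1} ^ 'n ^ 'n"
  assumes "(A \<longlongrightarrow> a) F"
  shows "((\<lambda>x. det (A x)) \<longlongrightarrow> det a) F"
  unfolding det_def by (intro tendsto_intros assms)

text \<open>By Cramer's rule the entries of the inverse are quotients of determinants, and the
  denominator stays away from zero near the limit.\<close>

lemma tendsto_matrix_inv:
  fixes A :: "'x \<Rightarrow> 'a::real_normed_field ^ 'n ^ 'n"
  assumes lim: "(A \<longlongrightarrow> a) F" and inv: "invertible a"
  shows "((\<lambda>x. matrix_inv (A x)) \<longlongrightarrow> matrix_inv a) F"
proof -
  \<comment> \<open>The determinant of \<open>B\<close> with column \<open>k\<close> replaced by the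
    \<open>l\<close>-th unit vector, that is, the entry of the adjugate in row \<open>k\<close> and
    column \<open>l\<close>.\<close>
  define D where "D B k l = det (\<chi> i j. if j = k then axis l 1 $ i else B $ i $ j)"
    for B :: "'a ^ 'n ^ 'n" and k l
  have cramer_inv: "matrix_inv B $ k $ l = D B k l / det B" if "det B \<noteq> 0" for B :: "'a ^ 'n ^ 'n" and k l
  proof -
    \<comment> \<open>The \<open>l\<close>-th column of the inverse is the solution for the
      \<open>l\<close>-th unit vector.\<close>
    have "B *v (matrix_inv B *v axis l 1) = axis l 1"
      using that by (simp add: matrix_vector_mul_assoc matrix_mult_matrix_inv invertible_det_nz)
    then have "matrix_inv B *v axis l 1 = (\<chi> k. D B k l / det B)"
      unfolding D_def by (simp add: cramer [OF that])
    moreover have "(matrix_inv B *v axis l 1) $ k = matrix_inv B $ k $ l"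
      by (simp add: matrix_vector_mult_def axis_def if_distrib if_distribR sum.delta' cong: if_cong)
    ultimately show ?thesis by simp
  qed
  have det0: "det a \<noteq> 0"
    using inv by (simp add: invertible_det_nz)
  have det_lim: "((\<lambda>x. det (A x)) \<longlongrightarrow> det a) F"
    by (rule tendsto_det [OF lim])
  have ev: "\<forall>\<^sub>F x in F. det (A x) \<noteq> 0"
    using tendsto_imp_eventually_ne [OF det_lim det0] .
  show ?thesis
  proof (rule tendsto_matrixI)
    fix k l
    have "((\<lambda>x. D (A x) k l) \<longlongrightarrow> D a k l) F"
      unfolding D_def
      by (intro tendsto_det tendsto_matrixI) (auto intro!: tendsto_intros lim)
    then have "((\<lambda>x. D (A x) k l / det (A x)) \<longlongrightarrow> D a k l / det a) F"
      by (intro tendsto_divide det_lim det0)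
    moreover have "\<forall>\<^sub>F x in F. matrix_inv (A x) $ k $ l = D (A x) k l / det (A x)"
      using ev by eventually_elim (rule cramer_inv)
    ultimately show "((\<lambda>x. matrix_inv (A x) $ k $ l) \<longlongrightarrow> matrix_inv a $ k $ l) F"
      unfolding cramer_inv [OF det0] by (simp add: tendsto_cong)
  qed
qed

section \<open>The rescaled pencil and its value at \<epsilon> = 0\<close>

text \<open>This is s I - F for the perturbed system before regrouping, with the second block row
  multiplied by \<epsilon>. The factor 1/\<epsilon> is thereby gone, and \<epsilon> = 0 is an
  admissible value.\<close>

definition pencil ::
  "complex ^ ('n1::finite + 'n1) ^ ('n1 + 'n1) \<Rightarrow> complex ^ ('n2::finite + 'n2) ^ ('n1 + 'n1) \<Rightarrow>
   complex ^ ('n1 + 'n1) ^ ('n2 + 'n2) \<Rightarrow> complex ^ ('n2 + 'n2) ^ ('n2 + 'n2) \<Rightarrow>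
   complex \<Rightarrow> real \<Rightarrow> complex ^ (('n1 + 'n1) + ('n2 + 'n2)) ^ (('n1 + 'n1) + ('n2 + 'n2))" where
  "pencil Fa Fb Fc Fd s \<epsilon> = four_block (mat s - Fa) (- Fb) (- Fc) (mat (of_real \<epsilon> * s) - Fd)"

lemma tendsto_pencil:
  "(pencil Fa Fb Fc Fd s \<longlongrightarrow> pencil Fa Fb Fc Fd s 0) (at_right 0)"
proof (rule tendsto_matrixI)
  fix i j
  have lim: "((\<lambda>\<epsilon>. complex_of_real \<epsilon> * s) \<longlongrightarrow> of_real 0 * s) (at_right 0)"
    by (intro tendsto_intros)
  show "((\<lambda>\<epsilon>. pencil Fa Fb Fc Fd s \<epsilon> $ i $ j) \<longlongrightarrow> pencil Fa Fb Fc Fd s 0 $ i $ j) (at_right 0)"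
    using lim
    by (cases i; cases j; cases "i = j")
      (auto simp: pencil_def four_block_def mat_def intro!: tendsto_eq_intros)
qed

text \<open>Dividing the second block row by \<epsilon> and regrouping undoes the rescaling; the
  result has the form that \<open>transfer_unitary\<close> expects.\<close>

lemma pencil_solution_perturbed:
  fixes X :: "complex ^ ('m::finite + 'm) ^ (('n1::finite + 'n1) + ('n2::finite + 'n2))"
  assumes "\<epsilon> > 0" and sol: "pencil Fa Fb Fc Fd s \<epsilon> ** X = above Ga Gb"
  shows "mat s ** regroup_rows X =
    perturbed_G \<epsilon> Ga Gb + perturbed_F \<epsilon> Fa Fb Fc Fd ** regroup_rows X"
proof -
  obtain X1 X2 where X: "X = above X1 X2" by (rule above_cases)
  from sol have eqs: "(mat s - Fa) ** X1 + (- Fb) ** X2 = Ga"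
      "(- Fc) ** X1 + (mat (of_real \<epsilon> * s) - Fd) ** X2 = Gb"
    by (simp_all only: X pencil_def four_block_mult_above above_eq_iff)
  have 1: "mat s ** X1 = Ga + (Fa ** X1 + Fb ** X2)"
    using eqs(1) by (auto simp: matrix_diff_rdistrib)
  have "mat (of_real \<epsilon> * s) ** X2 = \<epsilon> *\<^sub>R (mat s ** X2)"
    by (rule matrix_eqI) (simp, simp add: scaleR_conv_of_real)
  then have "\<epsilon> *\<^sub>R (mat s ** X2) = Gb + (Fc ** X1 + Fd ** X2)"
    using eqs(2) by (auto simp: matrix_diff_rdistrib)
  then have "(1 / \<epsilon>) *\<^sub>R (\<epsilon> *\<^sub>R (mat s ** X2)) = (1 / \<epsilon>) *\<^sub>R (Gb + (Fc ** X1 + Fd ** X2))"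
    by simp
  then have 2: "mat s ** X2 = (1 / \<epsilon>) *\<^sub>R Gb
      + (((1 / \<epsilon>) *\<^sub>R Fc) ** X1 + ((1 / \<epsilon>) *\<^sub>R Fd) ** X2)"
    using \<open>\<epsilon> > 0\<close> by (simp add: scaleR_add_right scalar_matrix_assoc)
  have "mat s ** X = above Ga ((1 / \<epsilon>) *\<^sub>R Gb)
      + four_block Fa Fb ((1 / \<epsilon>) *\<^sub>R Fc) ((1 / \<epsilon>) *\<^sub>R Fd) ** X"
    unfolding X by (simp only: mat_mult_above four_block_mult_above above_add 1 2)
  then show ?thesis
    by (simp add: mat_mult_regroup_rows perturbed_F_def perturbed_G_def regroup_rows_mult
        regroup_cols_mult_regroup_rows regroup_rows_add)
qed

text \<open>Eliminating the second block row of the pencil at \<open>\<epsilon> = 0\<close> (Schur complement) yields the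
  reduced system.\<close>

lemma pencil_0_solution:
  assumes Fd: "invertible Fd"
    and sol: "pencil Fa Fb Fc Fd s 0 ** X = above Ga Gb"
  obtains X1 where "(mat s - (Fa - Fb ** matrix_inv Fd ** Fc)) ** X1 = Ga - Fb ** matrix_inv Fd ** Gb"
    and "beside Ha Hb ** X + K =
      (Ha - Hb ** matrix_inv Fd ** Fc) ** X1 + (K - Hb ** matrix_inv Fd ** Gb)"
proof -
  obtain X1 X2 where X: "X = above X1 X2" by (rule above_cases)
  from sol have eqs: "(mat s - Fa) ** X1 + (- Fb) ** X2 = Ga"
      "(- Fc) ** X1 + (mat (of_real 0 * s) - Fd) ** X2 = Gb"
    by (simp_all only: X pencil_def four_block_mult_above above_eq_iff)
  have "Fd ** X2 = - (Gb + Fc ** X1)"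
    unfolding eqs(2) [symmetric] by (simp add: matrix_diff_rdistrib)
  then have "matrix_inv Fd ** (Fd ** X2) = matrix_inv Fd ** (- (Gb + Fc ** X1))"
    by simp
  then have X2: "X2 = - (matrix_inv Fd ** (Gb + Fc ** X1))"
    by (simp add: matrix_mul_assoc matrix_inv_matrix_mult Fd matrix_add_ldistrib
        matrix_diff_ldistrib)
  show ?thesis
  proof
    show "(mat s - (Fa - Fb ** matrix_inv Fd ** Fc)) ** X1 = Ga - Fb ** matrix_inv Fd ** Gb"
      unfolding eqs(1) [symmetric] X2
      by (simp add: matrix_diff_rdistrib matrix_diff_ldistrib matrix_add_rdistrib
          matrix_add_ldistrib matrix_mul_assoc algebra_simps)
    show "beside Ha Hb ** X + K =
        (Ha - Hb ** matrix_inv Fd ** Fc) ** X1 + (K - Hb ** matrix_inv Fd ** Gb)"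
      unfolding X X2 beside_mult_above
      by (simp add: matrix_diff_rdistrib matrix_diff_ldistrib matrix_add_rdistrib
          matrix_add_ldistrib matrix_mul_assoc algebra_simps)
  qed
qed

text \<open>Block elimination solves the system for every right-hand side, in particular for the
  identity, and a right inverse of a square matrix is an inverse.\<close>

lemma invertible_pencil_0:
  assumes Fd: "invertible Fd" and inv: "invertible (mat s - (Fa - Fb ** matrix_inv Fd ** Fc))"
  shows "invertible (pencil Fa Fb Fc Fd s 0)"
proof -
  define Q where "Q = mat s - (Fa - Fb ** matrix_inv Fd ** Fc)"
  have Q: "Q ** matrix_inv Q = mat 1" "Fd ** matrix_inv Fd = mat 1"
    using inv Fd by (simp_all add: Q_def matrix_mult_matrix_inv)
  \<comment> \<open>Expresses the upper left block through the Schur complement \<open>Q\<close>,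
    whose action on \<open>X1\<close> is known.\<close>
  have FbX: "(mat s - Fa) ** Y = Q ** Y - Fb ** matrix_inv Fd ** Fc ** Y"
    for Y :: "complex ^ 'k ^ _"
    by (simp add: Q_def matrix_diff_rdistrib matrix_mul_assoc)
  have "\<exists>X. pencil Fa Fb Fc Fd s 0 ** X = above A B" for A B
  proof
    \<comment> \<open>The first component comes from the Schur complement equation; the second one,
      used below, solves the second block row for given \<open>X1\<close>.\<close>
    define X1 where "X1 = matrix_inv Q ** (A - Fb ** matrix_inv Fd ** B)"
    have QX1: "Q ** X1 = A - Fb ** matrix_inv Fd ** B"
      by (simp add: X1_def matrix_mul_assoc Q)
    show "pencil Fa Fb Fc Fd s 0 ** above X1 (- (matrix_inv Fd ** (B + Fc ** X1))) = above A B"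
      unfolding pencil_def four_block_mult_above above_eq_iff FbX QX1
      by (simp add: matrix_add_ldistrib matrix_diff_ldistrib matrix_mul_assoc Q algebra_simps)
  qed
  \<comment> \<open>The identity matrix is itself of the form \<open>above A B\<close>.\<close>
  then show ?thesis
    unfolding invertible_right_inverse by (metis above_cases)
qed

text \<open>\<open>V\<close> and \<open>W\<close> are the resolvents of \<open>F0\<close> at
  \<open>s\<close> and \<open>- cnj s\<close>; their existence keeps both points off the spectrum of
  \<open>F0\<close>. There the pencil at \<epsilon> = 0 is invertible, so the perturbed identity
  passes to the limit.\<close>

lemma reduced_unitary_pointwise:
  fixes Fa :: "complex ^ ('n1::finite + 'n1) ^ ('n1 + 'n1)"
    and Fd :: "complex ^ ('n2::finite + 'n2) ^ ('n2 + 'n2)"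
    and K :: "complex ^ ('m::finite + 'm) ^ ('m + 'm)"
  assumes realizable: "\<And>\<epsilon>::real. \<epsilon> > 0 \<Longrightarrow>
      physically_realizable (perturbed_F \<epsilon> Fa Fb Fc Fd) (perturbed_G \<epsilon> Ga Gb) (perturbed_H Ha Hb) K"
    and Fd: "invertible Fd"
  defines "F0 \<equiv> Fa - Fb ** matrix_inv Fd ** Fc"
    and "G0 \<equiv> Ga - Fb ** matrix_inv Fd ** Gb"
    and "H0 \<equiv> Ha - Hb ** matrix_inv Fd ** Fc"
    and "K0 \<equiv> K - Hb ** matrix_inv Fd ** Gb"
  assumes V: "V ** (mat s - F0) = mat 1" and W: "W ** (mat (- cnj s) - F0) = mat 1"
  shows "dagger (H0 ** W ** G0 + K0) ** Jmat ** (H0 ** V ** G0 + K0) = Jmat"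
proof -
  define A where "A z \<epsilon> = pencil Fa Fb Fc Fd z \<epsilon>" for z \<epsilon>
  define X where "X z \<epsilon> = matrix_inv (A z \<epsilon>) ** above Ga Gb" for z \<epsilon>
  \<comment> \<open>One family covers both systems: wherever the pencil is invertible, this is the
    perturbed transfer function for \<epsilon> > 0 and the reduced one at \<epsilon> = 0.\<close>
  define \<Phi> where "\<Phi> z \<epsilon> = beside Ha Hb ** X z \<epsilon> + K" for z \<epsilon>
  have inv0: "invertible (A z 0)" if "U ** (mat z - F0) = mat 1" for z U
    unfolding A_def
    by (intro invertible_pencil_0 Fd) (use that in \<open>auto simp: F0_def invertible_left_inverse\<close>)
  have \<Phi>0: "\<Phi> z 0 = H0 ** U ** G0 + K0" if U: "U ** (mat z - F0) = mat 1" for z U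
  proof -
    have sol: "pencil Fa Fb Fc Fd z 0 ** X z 0 = above Ga Gb"
      using matrix_mult_matrix_inv [OF inv0 [OF U]] by (simp add: X_def A_def matrix_mul_assoc)
    obtain X1 where X1: "(mat z - F0) ** X1 = G0" and \<Phi>X: "\<Phi> z 0 = H0 ** X1 + K0"
      using pencil_0_solution [OF Fd sol, of Ha Hb K]
      unfolding F0_def G0_def H0_def K0_def \<Phi>_def by blast
    have "X1 = U ** G0"
      using arg_cong [OF X1, of "(**) U"] U by (simp add: matrix_mul_assoc)
    then show ?thesis by (simp add: \<Phi>X matrix_mul_assoc)
  qed
  have lim: "(\<Phi> z \<longlongrightarrow> \<Phi> z 0) (at_right 0)" if "U ** (mat z - F0) = mat 1" for z U
    unfolding \<Phi>_def X_def A_def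
    by (intro tendsto_intros tendsto_matrix_inv tendsto_pencil)
      (use inv0 [OF that] in \<open>simp add: A_def\<close>)
  have ev: "\<forall>\<^sub>F \<epsilon> in at_right 0. invertible (A z \<epsilon>)" if "U ** (mat z - F0) = mat 1" for z U
  proof -
    have "((\<lambda>\<epsilon>. det (A z \<epsilon>)) \<longlongrightarrow> det (A z 0)) (at_right 0)"
      unfolding A_def by (intro tendsto_det tendsto_pencil)
    then show ?thesis
      unfolding invertible_det_nz
      by (rule tendsto_imp_eventually_ne) (use inv0 [OF that] in \<open>simp add: invertible_det_nz\<close>)
  qed
  have pos: "\<forall>\<^sub>F \<epsilon> in at_right (0::real). \<epsilon> > 0"
    by (simp add: eventually_at_right_less)
  have "\<forall>\<^sub>F \<epsilon> in at_right 0. dagger (\<Phi> (- cnj s) \<epsilon>) ** Jmat ** \<Phi> s \<epsilon> = Jmat"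
    using pos ev [OF V] ev [OF W]
  proof eventually_elim
    case (elim \<epsilon>)
    have \<Phi>': "\<Phi> z \<epsilon> = perturbed_H Ha Hb ** regroup_rows (X z \<epsilon>) + K" for z
      by (simp add: \<Phi>_def perturbed_H_def regroup_cols_mult_regroup_rows)
    have "pencil Fa Fb Fc Fd z \<epsilon> ** X z \<epsilon> = above Ga Gb" if "invertible (A z \<epsilon>)" for z
      using matrix_mult_matrix_inv [OF that] by (simp add: X_def A_def matrix_mul_assoc)
    \<comment> \<open>Both pencils are invertible for this \<epsilon>, so \<open>X\<close> solves
      the perturbed equations at \<open>s\<close> and at \<open>- cnj s\<close>.\<close>
    then show ?case
      unfolding \<Phi>' using elim
      by (intro transfer_unitary [OF realizable] pencil_solution_perturbed) auto
  qed
  moreover have "((\<lambda>\<epsilon>. dagger (\<Phi> (- cnj s) \<epsilon>) ** Jmat ** \<Phi> s \<epsilon>)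
      \<longlongrightarrow> dagger (\<Phi> (- cnj s) 0) ** Jmat ** \<Phi> s 0) (at_right 0)"
    by (intro tendsto_intros lim [OF V] lim [OF W])
  \<comment> \<open>The convergent product is eventually the constant \<open>Jmat\<close>;
    uniqueness of limits then identifies its limit.\<close>
  ultimately have "((\<lambda>\<epsilon>::real. Jmat) \<longlongrightarrow> dagger (\<Phi> (- cnj s) 0) ** Jmat ** \<Phi> s 0) (at_right 0)"
    by (simp add: tendsto_cong)
  then show ?thesis
    unfolding \<Phi>0 [OF V] \<Phi>0 [OF W]
    by (simp add: tendsto_const_iff)
qed


section \<open>Evaluation of rational functions\<close>

text \<open>A relation rather than a function, since there is no value at a pole. Any representative
  with nonvanishing denominator at \<open>s\<close> may serve, so common factors do no harm.\<close>

definition evaluates_to :: "ratfun \<Rightarrow> complex \<Rightarrow> complex \<Rightarrow> bool" where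
  "evaluates_to r s c \<longleftrightarrow> (\<exists>p q. r = Fract p q \<and> poly q s \<noteq> 0 \<and> poly p s = c * poly q s)"

lemma evaluates_toI:
  "r = Fract p q \<Longrightarrow> poly q s \<noteq> 0 \<Longrightarrow> poly p s = c * poly q s \<Longrightarrow> evaluates_to r s c"
  by (auto simp: evaluates_to_def)

lemma evaluates_toE:
  assumes "evaluates_to r s c"
  obtains p q where "r = Fract p q" "q \<noteq> 0" "poly q s \<noteq> 0" "poly p s = c * poly q s"
  using assms unfolding evaluates_to_def by (metis poly_0)

lemma evaluates_to_poly: "evaluates_to (to_fract p) s (poly p s)"
  by (rule evaluates_toI [of _ p 1]) (simp_all add: to_fract_def)

lemma evaluates_to_rat_const: "evaluates_to (rat_const c) s c"
  using evaluates_to_poly [of "[:c:]"] by (simp add: rat_const_def)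

lemma evaluates_to_rat_s: "evaluates_to rat_s s s"
  using evaluates_to_poly [of "[:0, 1:]"] by (simp add: rat_s_def)

lemma evaluates_to_0: "evaluates_to 0 s 0"
  using evaluates_to_poly [of 0] by simp

lemma evaluates_to_1: "evaluates_to 1 s 1"
  using evaluates_to_poly [of 1] by simp

lemma evaluates_to_add:
  assumes "evaluates_to r s c" "evaluates_to r' s c'"
  shows "evaluates_to (r + r') s (c + c')"
proof -
  obtain p q where r: "r = Fract p q" "q \<noteq> 0" "poly q s \<noteq> 0" "poly p s = c * poly q s"
    using assms(1) by (rule evaluates_toE)
  obtain p' q' where r': "r' = Fract p' q'" "q' \<noteq> 0" "poly q' s \<noteq> 0" "poly p' s = c' * poly q' s"
    using assms(2) by (rule evaluates_toE)
  show ?thesis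
    by (rule evaluates_toI [of _ "p * q' + p' * q" "q * q'"])
      (use r r' in \<open>simp_all add: algebra_simps\<close>)
qed

lemma evaluates_to_mult:
  assumes "evaluates_to r s c" "evaluates_to r' s c'"
  shows "evaluates_to (r * r') s (c * c')"
proof -
  obtain p q where r: "r = Fract p q" "q \<noteq> 0" "poly q s \<noteq> 0" "poly p s = c * poly q s"
    using assms(1) by (rule evaluates_toE)
  obtain p' q' where r': "r' = Fract p' q'" "q' \<noteq> 0" "poly q' s \<noteq> 0" "poly p' s = c' * poly q' s"
    using assms(2) by (rule evaluates_toE)
  show ?thesis
    by (rule evaluates_toI [of _ "p * p'" "q * q'"])
      (use r r' in simp_all)
qed

lemma evaluates_to_uminus: "evaluates_to r s c \<Longrightarrow> evaluates_to (- r) s (- c)"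
  using evaluates_to_mult [OF evaluates_to_poly [of "- 1" s], of r c] by simp

lemma evaluates_to_diff:
  "evaluates_to r s c \<Longrightarrow> evaluates_to r' s c' \<Longrightarrow> evaluates_to (r - r') s (c - c')"
  using evaluates_to_add [OF _ evaluates_to_uminus, of r s c r' c'] by simp

lemma evaluates_to_sum:
  "(\<And>i. i \<in> I \<Longrightarrow> evaluates_to (f i) s (g i)) \<Longrightarrow> evaluates_to (sum f I) s (sum g I)"
  by (induction I rule: infinite_finite_induct) (auto intro: evaluates_to_0 evaluates_to_add)

lemma evaluates_to_prod:
  "(\<And>i. i \<in> I \<Longrightarrow> evaluates_to (f i) s (g i)) \<Longrightarrow> evaluates_to (prod f I) s (prod g I)"
  by (induction I rule: infinite_finite_induct) (auto intro: evaluates_to_1 evaluates_to_mult)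

text \<open>The new denominator at \<open>s\<close> is the conjugate of the old one at
  \<open>- cnj s\<close>, hence still nonzero.\<close>

lemma evaluates_to_para_conj:
  assumes "evaluates_to r (- cnj s) c"
  shows "evaluates_to (para_conj r) s (cnj c)"
proof -
  obtain p q where r: "r = Fract p q" "q \<noteq> 0" "poly q (- cnj s) \<noteq> 0"
      "poly p (- cnj s) = c * poly q (- cnj s)"
    using assms by (rule evaluates_toE)
  show ?thesis
    by (rule evaluates_toI [of _ "para_poly p" "para_poly q"])
      (use r in \<open>simp_all add: para_conj_Fract poly_para_poly\<close>)
qed

text \<open>The fraction that witnesses the value may differ from the given one;
  cross-multiplication carries the zero over, because the witnessing denominator does not vanish at
  \<open>s\<close>.\<close>

lemma evaluates_to_0_Fract:
  assumes "evaluates_to (Fract p q) s 0" "q \<noteq> 0"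
  shows "poly p s = 0"
proof -
  obtain p' q' where r: "Fract p q = Fract p' q'" "q' \<noteq> 0" "poly q' s \<noteq> 0" "poly p' s = 0 * poly q' s"
    using assms(1) by (rule evaluates_toE)
  then have "p * q' = p' * q"
    using assms(2) by (simp add: eq_fract)
  then have "poly p s * poly q' s = poly p' s * poly q s"
    by (metis poly_mult)
  then show ?thesis using r by simp
qed

text \<open>Subtracting the two evaluations gives the zero function the value \<open>c - d\<close>,
  and every fraction representing zero has numerator zero.\<close>

lemma evaluates_to_unique:
  assumes "evaluates_to r s c" "evaluates_to r s d"
  shows "c = d"
proof -
  have "evaluates_to (Fract 0 1) s (c - d)"
    using evaluates_to_diff [OF assms] by (simp add: Zero_fract_def)
  then obtain p q where "Fract p q = Fract 0 1" "q \<noteq> 0" "poly q s \<noteq> 0" "poly p s = (c - d) * poly q s"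
    by (metis evaluates_toE)
  then show ?thesis by (simp add: eq_fract)
qed

lemma eventually_evaluates: "\<forall>\<^sub>F s in cofinite. \<exists>c. evaluates_to r s c"
proof (cases r)
  case (Fract p q)
  then have "finite {s. poly q s = 0}"
    by (simp add: poly_roots_finite)
  then have "\<forall>\<^sub>F s in cofinite. poly q s \<noteq> 0"
    by (simp add: eventually_cofinite)
  then show ?thesis
  proof eventually_elim
    case (elim s)
    then have "evaluates_to r s (poly p s / poly q s)"
      by (intro evaluates_toI [OF Fract(1)]) simp_all
    then show ?case ..
  qed
qed

text \<open>The numerator would have infinitely many roots unless it is the zero polynomial.\<close>

lemma eventually_evaluates_to_0_imp_eq_0:
  assumes "\<forall>\<^sub>F s in cofinite. evaluates_to r s 0"
  shows "r = 0"
proof (cases r)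
  case (Fract p q)
  have "\<forall>\<^sub>F s in cofinite. poly p s = 0"
    using assms by eventually_elim (use Fract in \<open>auto intro: evaluates_to_0_Fract\<close>)
  moreover have "\<forall>\<^sub>F s in cofinite. poly p s \<noteq> 0" if "p \<noteq> 0"
    using poly_roots_finite [OF that] by (simp add: eventually_cofinite)
  \<comment> \<open>For nonzero \<open>p\<close> both statements would hold at a common point, as
    the complex plane is infinite.\<close>
  ultimately have "p = 0"
    using eventually_conj [of "\<lambda>s. poly p s = 0" cofinite "\<lambda>s. poly p s \<noteq> 0"]
    by (auto simp: infinite_UNIV_char_0 eventually_False cofinite_bot)
  then show ?thesis using Fract by (simp add: fract_collapse)
qed

section \<open>Entrywise evaluation of rational matrices\<close>

definition matrix_evaluates_to :: "ratfun ^ 'c ^ 'r \<Rightarrow> complex \<Rightarrow> complex ^ 'c ^ 'r \<Rightarrow> bool" where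
  "matrix_evaluates_to R s C \<longleftrightarrow> (\<forall>i j. evaluates_to (R $ i $ j) s (C $ i $ j))"

lemma matrix_evaluates_to_mult:
  "matrix_evaluates_to R s C \<Longrightarrow> matrix_evaluates_to R' s C' \<Longrightarrow>
    matrix_evaluates_to (R ** R') s (C ** C')"
  by (auto simp: matrix_evaluates_to_def matrix_mult_nth
      intro!: evaluates_to_sum evaluates_to_mult)

lemma matrix_evaluates_to_add:
  "matrix_evaluates_to R s C \<Longrightarrow> matrix_evaluates_to R' s C' \<Longrightarrow>
    matrix_evaluates_to (R + R') s (C + C')"
  by (simp add: matrix_evaluates_to_def evaluates_to_add)

lemma matrix_evaluates_to_diff:
  "matrix_evaluates_to R s C \<Longrightarrow> matrix_evaluates_to R' s C' \<Longrightarrow>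
    matrix_evaluates_to (R - R') s (C - C')"
  by (simp add: matrix_evaluates_to_def evaluates_to_diff)

lemma matrix_evaluates_to_rat_const: "matrix_evaluates_to (map_matrix rat_const C) s C"
  by (simp add: matrix_evaluates_to_def evaluates_to_rat_const)

lemma matrix_evaluates_to_mat: "evaluates_to r s c \<Longrightarrow> matrix_evaluates_to (mat r) s (mat c)"
  by (simp add: matrix_evaluates_to_def mat_def evaluates_to_0)

lemma matrix_evaluates_to_Jmat: "matrix_evaluates_to Jmat s Jmat"
  unfolding matrix_evaluates_to_def
proof (intro allI)
  fix i j :: "'k::finite + 'k"
  show "evaluates_to (Jmat $ i $ j) s (Jmat $ i $ j)"
    by (cases i; cases j)
      (auto simp: Jmat_def four_block_def mat_def
        intro!: evaluates_to_0 evaluates_to_1 evaluates_to_uminus)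
qed

lemma matrix_evaluates_to_para:
  "matrix_evaluates_to R (- cnj s) C \<Longrightarrow> matrix_evaluates_to (para R) s (dagger C)"
  by (simp add: matrix_evaluates_to_def para_def transpose_def evaluates_to_para_conj)

lemma matrix_evaluates_to_unique:
  "matrix_evaluates_to R s C \<Longrightarrow> matrix_evaluates_to R s D \<Longrightarrow> C = D"
  unfolding matrix_evaluates_to_def vec_eq_iff by (metis evaluates_to_unique)

text \<open>The Leibniz formula consists of sums and products, with signs 1 and -1.\<close>

lemma evaluates_to_det:
  assumes "matrix_evaluates_to R s C"
  shows "evaluates_to (det R) s (det C)"
proof -
  have "evaluates_to (of_int (sign p)) s (of_int (sign p))" for p :: "'a \<Rightarrow> 'a"
    by (cases p rule: sign_cases) (simp_all add: evaluates_to_1 evaluates_to_uminus)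
  then show ?thesis
    unfolding det_def using assms
    by (intro evaluates_to_sum evaluates_to_mult evaluates_to_prod)
      (simp_all add: matrix_evaluates_to_def)
qed

lemma eventually_matrix_evaluates: "\<forall>\<^sub>F s in cofinite. \<exists>C. matrix_evaluates_to R s C"
proof -
  have "\<forall>\<^sub>F s in cofinite. \<forall>i. \<forall>j. \<exists>c. evaluates_to (R $ i $ j) s c"
    by (intro eventually_all_finite eventually_evaluates)
  then show ?thesis
  proof eventually_elim
    case (elim s)
    then obtain c where "\<And>i j. evaluates_to (R $ i $ j) s (c i j)" by metis
    then have "matrix_evaluates_to R s (\<chi> i j. c i j)"
      by (simp add: matrix_evaluates_to_def)
    then show ?case ..
  qed
qed


section \<open>Transfer functions\<close>

text \<open>The determinant of I - \<epsilon> F tends to 1 as \<epsilon> tends to 0, so s I - F is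
  invertible at some large number s. A determinant with a nonzero value at one point is a nonzero
  element of the field.\<close>

lemma invertible_resolvent:
  fixes F :: "complex ^ 'n ^ 'n"
  shows "invertible (mat rat_s - map_matrix rat_const F)"
proof -
  have "((\<lambda>\<epsilon>. mat 1 - mat (complex_of_real \<epsilon>) ** F) \<longlongrightarrow> mat 1) (at_right 0)"
    by (rule tendsto_matrixI) (auto intro!: tendsto_eq_intros)
  then have "((\<lambda>\<epsilon>. det (mat 1 - mat (complex_of_real \<epsilon>) ** F)) \<longlongrightarrow> det (mat 1 :: complex ^ 'n ^ 'n)) (at_right 0)"
    by (rule tendsto_det)
  then have "\<forall>\<^sub>F \<epsilon> in at_right 0. det (mat 1 - mat (complex_of_real \<epsilon>) ** F) \<noteq> 0"
    by (rule tendsto_imp_eventually_ne) simp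
  moreover have "\<forall>\<^sub>F \<epsilon> in at_right (0::real). \<epsilon> > 0"
    by (simp add: eventually_at_right_less)
  ultimately have "\<forall>\<^sub>F \<epsilon> in at_right 0. \<epsilon> > 0 \<and> det (mat 1 - mat (complex_of_real \<epsilon>) ** F) \<noteq> 0"
    by (simp add: eventually_conj)
  then have "\<exists>\<epsilon>. \<epsilon> > 0 \<and> det (mat 1 - mat (complex_of_real \<epsilon>) ** F) \<noteq> 0"
    by (rule eventually_happens' [OF trivial_limit_at_right_real])
  then obtain \<epsilon> where \<epsilon>: "\<epsilon> > 0" and det: "det (mat 1 - mat (complex_of_real \<epsilon>) ** F) \<noteq> 0"
    by blast
  \<comment> \<open>Chosen so that I - \<epsilon> F = \<epsilon> (s I - F).\<close>
  define s where "s = 1 / complex_of_real \<epsilon>"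
  have "(mat (of_real \<epsilon>) ** mat s :: complex ^ 'n ^ 'n) = mat 1"
    by (rule matrix_eqI) (use \<epsilon> in \<open>simp, simp add: mat_def s_def\<close>)
  then have "mat 1 - mat (complex_of_real \<epsilon>) ** F = mat (of_real \<epsilon>) ** (mat s - F)"
    by (simp add: matrix_diff_ldistrib)
  then have "det (mat s - F) \<noteq> 0"
    using det by (auto simp: det_mul)
  moreover have "evaluates_to (det (mat rat_s - map_matrix rat_const F)) s (det (mat s - F))"
    by (intro evaluates_to_det matrix_evaluates_to_diff matrix_evaluates_to_mat
        matrix_evaluates_to_rat_const evaluates_to_rat_s)
  ultimately show ?thesis
    unfolding invertible_det_nz using evaluates_to_unique [OF evaluates_to_0] by metis
qed

text \<open>All entries of the inverse over the function field have values outside a finite set. As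
  evaluation respects products and is unique, the matrix \<open>W\<close> of these values is the
  numerical resolvent.\<close>

lemma eventually_transfer_function_evaluates:
  "\<forall>\<^sub>F s in cofinite. \<exists>W. W ** (mat s - F) = mat 1 \<and>
    matrix_evaluates_to (transfer_function F G H K) s (H ** W ** G + K)"
  using eventually_matrix_evaluates [of "matrix_inv (mat rat_s - map_matrix rat_const F)"]
proof eventually_elim
  case (elim s)
  let ?R = "mat rat_s - map_matrix rat_const F"
  obtain W where W: "matrix_evaluates_to (matrix_inv ?R) s W"
    using elim ..
  \<comment> \<open>The same product is evaluated twice: factor by factor, and as the identity
    matrix.\<close>
  have "matrix_evaluates_to (matrix_inv ?R ** ?R) s (W ** (mat s - F))"
    by (intro matrix_evaluates_to_mult matrix_evaluates_to_diff matrix_evaluates_to_mat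
        matrix_evaluates_to_rat_const evaluates_to_rat_s W)
  moreover have "matrix_evaluates_to (matrix_inv ?R ** ?R) s (mat 1)"
    by (simp add: matrix_inv_matrix_mult invertible_resolvent matrix_evaluates_to_mat evaluates_to_1)
  ultimately have "W ** (mat s - F) = mat 1"
    by (rule matrix_evaluates_to_unique)
  moreover have "matrix_evaluates_to (transfer_function F G H K) s (H ** W ** G + K)"
    unfolding transfer_function_def
    by (intro matrix_evaluates_to_mult matrix_evaluates_to_add matrix_evaluates_to_rat_const W)
  ultimately show ?case by blast
qed

text \<open>The reflection is injective, so the preimage of the finite exceptional set is
  finite.\<close>

lemma eventually_cofinite_minus_cnj:
  assumes "\<forall>\<^sub>F s in cofinite. P s"
  shows "\<forall>\<^sub>F s in cofinite. P (- cnj s)"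
proof -
  have "inj (\<lambda>s. - cnj s)"
    by (auto intro: injI)
  moreover have "finite {s. \<not> P s}"
    using assms by (simp only: eventually_cofinite)
  ultimately have "finite ((\<lambda>s. - cnj s) -` {s. \<not> P s})"
    by (intro finite_vimageI)
  then show ?thesis
    by (simp only: eventually_cofinite vimage_def mem_Collect_eq)
qed

text \<open>Reduces the identity over the function field to an identity of complex matrices at the
  points where both resolvents exist: the difference of the two sides then has value 0 at all but
  finitely many points.\<close>

lemma JJ_unitary_transfer_functionI:
  fixes F :: "complex ^ 'n ^ 'n" and H :: "complex ^ 'n ^ ('m::finite + 'm)"
  assumes "\<And>s V W. V ** (mat s - F) = mat 1 \<Longrightarrow> W ** (mat (- cnj s) - F) = mat 1 \<Longrightarrow>
    dagger (H ** W ** G + K) ** Jmat ** (H ** V ** G + K) = Jmat"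
  shows "JJ_unitary (transfer_function F G H K)"
proof -
  let ?\<Phi> = "transfer_function F G H K"
  note ev = eventually_transfer_function_evaluates [where F = F and G = G and H = H and K = K]
  have "\<forall>\<^sub>F s in cofinite. matrix_evaluates_to (para ?\<Phi> ** Jmat ** ?\<Phi> - Jmat) s 0"
    \<comment> \<open>The value of \<open>para\<close> at \<open>s\<close> comes from the transfer
      function at \<open>- cnj s\<close>, so the exceptional points of both arguments are
      excluded.\<close>
    using ev eventually_cofinite_minus_cnj [OF ev]
  proof eventually_elim
    case (elim s)
    then obtain V W where V: "V ** (mat s - F) = mat 1" "matrix_evaluates_to ?\<Phi> s (H ** V ** G + K)"
      and W: "W ** (mat (- cnj s) - F) = mat 1" "matrix_evaluates_to ?\<Phi> (- cnj s) (H ** W ** G + K)"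
      by blast
    have "matrix_evaluates_to (para ?\<Phi> ** Jmat ** ?\<Phi> - Jmat) s
        (dagger (H ** W ** G + K) ** Jmat ** (H ** V ** G + K) - Jmat)"
      by (intro matrix_evaluates_to_diff matrix_evaluates_to_mult matrix_evaluates_to_para
          matrix_evaluates_to_Jmat V W)
    then show ?case by (simp add: assms [OF V(1) W(1)])
  qed
  then have "(para ?\<Phi> ** Jmat ** ?\<Phi> - Jmat) $ i $ j = 0" for i j
    by (intro eventually_evaluates_to_0_imp_eq_0)
      (auto simp: matrix_evaluates_to_def elim: eventually_mono)
  then have "para ?\<Phi> ** Jmat ** ?\<Phi> = Jmat"
    by (simp add: vec_eq_iff)
  then show ?thesis by (simp add: JJ_unitary_def)
qed

theorem theorem2:
  fixes Fa :: "complex ^ ('n1::finite + 'n1) ^ ('n1 + 'n1)"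
    and Fb :: "complex ^ ('n2::finite + 'n2) ^ ('n1 + 'n1)"
    and Fc :: "complex ^ ('n1 + 'n1) ^ ('n2 + 'n2)"
    and Fd :: "complex ^ ('n2 + 'n2) ^ ('n2 + 'n2)"
    and Ga :: "complex ^ ('m::finite + 'm) ^ ('n1 + 'n1)"
    and Gb :: "complex ^ ('m + 'm) ^ ('n2 + 'n2)"
    and Ha :: "complex ^ ('n1 + 'n1) ^ ('m + 'm)"
    and Hb :: "complex ^ ('n2 + 'n2) ^ ('m + 'm)"
    and K :: "complex ^ ('m + 'm) ^ ('m + 'm)"
  assumes "doubled_up Fa" and "doubled_up Fb" and "doubled_up Fc" and "doubled_up Fd"
    and "doubled_up Ga" and "doubled_up Gb"
    and "doubled_up Ha" and "doubled_up Hb"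
    and "doubled_up K"
    and realizable: "\<And>\<epsilon>::real. \<epsilon> > 0 \<Longrightarrow>
      physically_realizable (perturbed_F \<epsilon> Fa Fb Fc Fd) (perturbed_G \<epsilon> Ga Gb) (perturbed_H Ha Hb) K"
    and "invertible Fd"
  defines "F0 \<equiv> Fa - Fb ** matrix_inv Fd ** Fc"
    and "G0 \<equiv> Ga - Fb ** matrix_inv Fd ** Gb"
    and "H0 \<equiv> Ha - Hb ** matrix_inv Fd ** Fc"
    and "K0 \<equiv> K - Hb ** matrix_inv Fd ** Gb"
  shows "JJ_unitary (transfer_function F0 G0 H0 K0)"
  unfolding F0_def G0_def H0_def K0_def
  by (rule JJ_unitary_transfer_functionI,
      rule reduced_unitary_pointwise [OF realizable \<open>invertible Fd\<close>])

end
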